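(* Let $\alpha>0$, $dt>0$, $dx>0$ and let $s\ge2$ be an integer. The $s$-stage RKG2 method applied to the constant coefficient heat equation under periodic or homogeneous Neumann boundary condition is monotone if it satisfies its stability constraint $$\alpha\frac{dt}{dx^2}\le\frac{(s+4)(s-1)}{12}.$$
   Context: Setting: the heat equation $u_t=\alpha u_{xx}$ with constant $\alpha>0$ is discretized in space by central differences as $\frac{du}{dt}=\alpha Mu$, where $u\in\mathbb{R}^{\mathbb{Z}}$, $[Mu]_i=\frac{[u]_{i+1}-2[u]_i+[u]_{i-1}}{dx^2}$, $dx>0$ is the grid size and $dt>0$ the (super) timestep. Periodic boundary conditions are treated as the boundaryless problem on $\mathbb{Z}$ with repeated values, and homogeneous Neumann boundary conditions as the periodic problem on the reflected and doubled domain; thus the scheme under either boundary condition is the scheme on $\mathbb{R}^{\mathbb{Z}}$. $C_s^{(\lambda)}$ denotes the Gegenbauer polynomial of degree $s$ with parameter $\lambda$: $C_0^{(\lambda)}(z)=1$, $C_1^{(\lambda)}(z)=2\lambda z$, $nC_n^{(\lambda)}(z)=2(n+\lambda-1)zC_{n-1}^{(\lambda)}(z)-(n+2\lambda-2)C_{n-2}^{(\lambda)}(z)$; throughout $\lambda=\frac32$. Polynomials are evaluated at operators in the usual way, and $I$ is the identity. One step of the $s$-stage RKG2 method ($s\ge2$) is $$u^{t+dt}=\Big[\Big(1-\frac{2(s-1)(s+4)}{3s(s+3)}\Big)I+\frac{4(s-1)(s+4)}{3s(s+1)(s+2)(s+3)}\,C_s^{(3/2)}\Big(I+\frac{6\,dt}{(s+4)(s-1)}\,\alpha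 M\Big)\Big]u^t.$$ A one-step method $u_i^{t+dt}=\mathcal{H}(u^t;i)$ (where $\mathcal H(\cdot\,;i)$ depends on finitely many entries of $u^t\in\mathbb{R}^{\mathbb Z}$) is called monotone if $\frac{\partial \mathcal{H}}{\partial u_j^t}(u^t;i)\ge 0$ for all grid indices $i,j\in\mathbb{Z}$ (and all $u^t$). *)

theory Defs
  imports "HOL-Computational_Algebra.Polynomial" Complex_Main
begin

text \<open>Grid functions are elements of \<open>int \<Rightarrow> real\<close>, i.e. of \<open>R^Z\<close>. The periodic problem is the
  boundaryless problem on \<open>Z\<close> with repeated values, and the homogeneous Neumann problem is the periodic
  problem on the reflected and doubled domain, so under either boundary condition the scheme is
  the one on \<open>int \<Rightarrow> real\<close> below.\<close>

fun gegenbauer :: "real \<Rightarrow> nat \<Rightarrow> real poly" where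
  "gegenbauer l 0 = 1"
| "gegenbauer l (Suc 0) = [:0, 2 * l:]"
| "gegenbauer l (Suc (Suc n)) =
     smult (1 / real (n + 2))
       (smult (2 * (real (n + 2) + l - 1)) ([:0, 1:] * gegenbauer l (Suc n))
        - smult (real (n + 2) + 2 * l - 2) (gegenbauer l n))"

lemma gegenbauer_recurrence:
  assumes "n \<ge> 2"
  shows "smult (real n) (gegenbauer l n) =
           smult (2 * (real n + l - 1)) ([:0, 1:] * gegenbauer l (n - 1))
           - smult (real n + 2 * l - 2) (gegenbauer l (n - 2))"
proof -
  obtain m where n: "n = Suc (Suc m)"
    using assms by (metis add_2_eq_Suc le_Suc_ex)
  have nz: "real (m + 2) \<noteq> 0" and e: "real n = real (m + 2)" by (simp_all add: n)
  show ?thesis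
    unfolding e unfolding n gegenbauer.simps smult_smult using nz by simp
qed

text \<open>Evaluation of a polynomial at an operator on grid functions; \<open>A ^^ k\<close> is the
  \<open>k\<close>-fold composition of \<open>A\<close>.\<close>

definition poly_op ::
  "real poly \<Rightarrow> ((int \<Rightarrow> real) \<Rightarrow> int \<Rightarrow> real) \<Rightarrow> (int \<Rightarrow> real) \<Rightarrow> int \<Rightarrow> real" where
  "poly_op p A u i = (\<Sum>k\<le>degree p. coeff p k * (A ^^ k) u i)"

definition central_diff :: "real \<Rightarrow> (int \<Rightarrow> real) \<Rightarrow> int \<Rightarrow> real" where
  "central_diff dx u i = (u (i + 1) - 2 * u i + u (i - 1)) / dx ^ 2"

definition rkg2_step ::
  "nat \<Rightarrow> real \<Rightarrow> real \<Rightarrow> real \<Rightarrow> (int \<Rightarrow> real) \<Rightarrow> int \<Rightarrow> real" where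
  "rkg2_step s \<alpha> dt dx u i =
     (1 - 2 * (real s - 1) * (real s + 4) / (3 * real s * (real s + 3))) * u i
     + 4 * (real s - 1) * (real s + 4) / (3 * real s * (real s + 1) * (real s + 2) * (real s + 3))
       * poly_op (gegenbauer (3/2) s)
           (\<lambda>v k. v k + 6 * dt / ((real s + 4) * (real s - 1)) * (\<alpha> * central_diff dx v k)) u i"

definition finite_stencil :: "((int \<Rightarrow> real) \<Rightarrow> int \<Rightarrow> real) \<Rightarrow> bool" where
  "finite_stencil H \<longleftrightarrow>
     (\<forall>i. \<exists>J. finite J \<and> (\<forall>u v. (\<forall>j\<in>J. u j = v j) \<longrightarrow> H u i = H v i))"

text \<open>The existence of the partial derivatives \<open>D\<close> is part of the requirement.\<close>

definition monotone_method :: "((int \<Rightarrow> real) \<Rightarrow> int \<Rightarrow> real) \<Rightarrow> bool" where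
  "monotone_method H \<longleftrightarrow> finite_stencil H \<and>
     (\<forall>u i j. \<exists>D. ((\<lambda>x. H (u(j := x)) i) has_real_derivative D) (at (u j)) \<and> D \<ge> 0)"

end

theory Submission
  imports Defs
begin

text \<open>With \<open>w = 6 \<alpha> dt / ((s + 4) (s - 1) dx\<^sup>2)\<close> and the shift \<open>X\<close> on grid functions, the operator to which
  \<open>C\<^sub>s\<close> (parameter \<open>3/2\<close>) is applied is \<open>R / X\<close> with \<open>R = w + (1 - 2 w) X + w X\<^sup>2\<close>, and the stability constraint says
  \<open>w \<le> 1/2\<close>. So \<open>2 w = sin\<^sup>2 \<phi>\<close> for some \<open>\<phi>\<close>, and \<open>R / X\<close> is \<open>cos\<^sup>2 \<phi> + sin\<^sup>2 \<phi> cos \<theta>\<close> on the Fourier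
  mode \<open>X = exp (i \<theta>)\<close>. By the addition theorem, the coefficients of the Laurent polynomial
  \<open>P\<^sub>n(R / X)\<close>, with \<open>P\<^sub>n\<close> the Legendre polynomial, are nonnegative multiples of squares. Since \<open>C\<^sub>s\<close> is the
  derivative of \<open>P\<^sub>s\<^sub>+\<^sub>1\<close>, applying \<open>X d/dX\<close> to \<open>P\<^sub>s\<^sub>+\<^sub>1(R / X)\<close> gives \<open>w (X - 1 / X) C\<^sub>s(R / X)\<close>, and dividing by
  \<open>X - 1 / X\<close> yields nonnegative coefficients again.\<close>

section \<open>Homogenized polynomials\<close>

lemma poly_eq_off_zeros:
  fixes f g v :: "real poly"
  assumes "v \<noteq> 0" "\<And>y. poly v y \<noteq> 0 \<Longrightarrow> poly f y = poly g y"
  shows "f = g"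
proof -
  have "poly (v * (f - g)) = poly 0"
    using assms(2) by (auto simp: fun_eq_iff)
  then have "v * (f - g) = 0"
    by (simp only: poly_eq_poly_eq_iff)
  then show ?thesis
    using assms(1) by simp
qed

text \<open>For \<open>degree p \<le> N\<close> this is \<open>v^N * p(u/v)\<close> with the
  denominators cleared; with \<open>v = X\<close> it stores the Laurent polynomial
  \<open>p(u/X)\<close> shifted by \<open>X^N\<close>.\<close>

definition homogenize :: "nat \<Rightarrow> real poly \<Rightarrow> real poly \<Rightarrow> real poly \<Rightarrow> real poly" where
  "homogenize N p u v = (\<Sum>k\<le>N. smult (coeff p k) (u ^ k * v ^ (N - k)))"

lemma poly_altdef_le:
  fixes p :: "real poly"
  assumes "degree p \<le> N"
  shows "poly p x = (\<Sum>k\<le>N. coeff p k * x ^ k)"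
  unfolding poly_altdef using assms
  by (intro sum.mono_neutral_left) (auto simp: coeff_eq_0)

lemma poly_homogenize:
  assumes "degree p \<le> N" "poly v y \<noteq> 0"
  shows "poly (homogenize N p u v) y = poly v y ^ N * poly p (poly u y / poly v y)"
proof -
  have "poly v y ^ (N - k) = poly v y ^ N / poly v y ^ k" if "k \<le> N" for k
    using assms(2) that by (simp add: power_diff)
  then show ?thesis
    unfolding homogenize_def poly_altdef_le[OF assms(1)]
    by (auto simp: poly_sum sum_distrib_left power_divide intro!: sum.cong)
qed

section \<open>Gegenbauer recurrences and derivatives of Legendre polynomials\<close>

lemma degree_gegenbauer_le: "degree (gegenbauer l n) \<le> n"
proof (induction l n rule: gegenbauer.induct)
  case (3 l n)
  have "degree ([:0, 1:] * gegenbauer l (Suc n)) \<le> Suc (Suc n)"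
    using 3(1) by (intro order.trans[OF degree_mult_le]) simp
  then show ?case
    using 3(2) unfolding gegenbauer.simps
    by (intro order.trans[OF degree_smult_le] degree_diff_le order.trans[OF degree_smult_le]) auto
qed (auto intro: order.trans[OF degree_pCons_le])

lemma gegenbauer_rec:
  "smult (real (n + 2)) (gegenbauer l (Suc (Suc n))) =
     smult (2 * (real n + l + 1)) ([:0, 1:] * gegenbauer l (Suc n))
     - smult (real n + 2 * l) (gegenbauer l n)"
  using gegenbauer_recurrence[of "Suc (Suc n)" l]
  by (simp del: gegenbauer.simps add: algebra_simps)

lemma poly_gegenbauer_rec:
  "real (n + 2) * poly (gegenbauer l (Suc (Suc n))) x =
     2 * (real n + l + 1) * (x * poly (gegenbauer l (Suc n)) x)
     - (real n + 2 * l) * poly (gegenbauer l n) x"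
  using arg_cong[OF gegenbauer_rec[of n l], of "\<lambda>p. poly p x"]
  by (simp del: gegenbauer.simps)

lemma poly_pderiv_gegenbauer_rec:
  "real (n + 2) * poly (pderiv (gegenbauer l (Suc (Suc n)))) x =
     2 * (real n + l + 1) * (poly (gegenbauer l (Suc n)) x + x * poly (pderiv (gegenbauer l (Suc n))) x)
     - (real n + 2 * l) * poly (pderiv (gegenbauer l n)) x"
  using arg_cong[OF gegenbauer_rec[of n l], of "\<lambda>p. poly (pderiv p) x"]
  by (simp del: gegenbauer.simps add: pderiv_smult pderiv_diff pderiv_pCons distrib_left mult.left_commute)

text \<open>Parameter \<open>1/2\<close> gives the Legendre polynomials. The two relations are
  proved jointly: the next instance of the first comes from the differentiated recurrence and the
  second, and the next instance of the second uses both.\<close>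

lemma pderiv_legendre_step:
  fixes x :: real
  defines "p \<equiv> \<lambda>n. poly (gegenbauer (1/2) n) x"
  defines "d \<equiv> \<lambda>n. poly (pderiv (gegenbauer (1/2) n)) x"
  shows "d (Suc n) = x * d n + real (n + 1) * p n \<and> x * d (Suc n) = d n + real (n + 1) * p (Suc n)"
proof (induction n)
  case 0
  show ?case by (simp add: p_def d_def pderiv_pCons)
next
  case (Suc n)
  have nz: "real (n + 2) \<noteq> 0" by simp
  have rp: "real (n + 2) * p (Suc (Suc n)) = (2 * real n + 3) * (x * p (Suc n)) - (real n + 1) * p n"
    using poly_gegenbauer_rec[of n "1/2" x] by (simp add: p_def algebra_simps)
  have rd: "real (n + 2) * d (Suc (Suc n))
      = (2 * real n + 3) * (p (Suc n) + x * d (Suc n)) - (real n + 1) * d n"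
    using poly_pderiv_gegenbauer_rec[of n "1/2" x] by (simp add: p_def d_def algebra_simps)
  have A: "d (Suc n) = x * d n + (real n + 1) * p n"
    using Suc[THEN conjunct1] by (simp only: of_nat_add of_nat_1)
  have B: "d n = x * d (Suc n) - (real n + 1) * p (Suc n)"
    using Suc[THEN conjunct2] unfolding of_nat_add of_nat_1 by linarith
  have "real (n + 2) * d (Suc (Suc n)) = real (n + 2) * (x * d (Suc n) + real (n + 2) * p (Suc n))"
    unfolding rd B by (simp add: algebra_simps)
  then have A': "d (Suc (Suc n)) = x * d (Suc n) + real (n + 2) * p (Suc n)"
    using nz by (metis mult_left_cancel)
  have xx: "x * (x * d (Suc n)) = x * d n + (real n + 1) * (x * p (Suc n))"
    unfolding B by (simp add: algebra_simps)
  have "x * d (Suc (Suc n)) = d (Suc n) + real (n + 2) * p (Suc (Suc n))"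
    unfolding A' rp distrib_left xx using A by (simp add: algebra_simps)
  with A' show ?case by simp
qed

text \<open>Eliminating the Legendre values from the two derivative relations leaves the three-term
  recurrence for parameter \<open>3/2\<close>.\<close>

lemma pderiv_legendre:
  "poly (pderiv (gegenbauer (1/2) (Suc n))) x = poly (gegenbauer (3/2) n) x"
proof (induction n rule: induct_nat_012)
  case 0
  show ?case by (simp add: pderiv_pCons)
next
  case 1
  show ?case by (simp add: pderiv_smult pderiv_diff pderiv_pCons pderiv_add algebra_simps)
next
  case (ge2 n)
  define p where "p = (\<lambda>n. poly (gegenbauer (1/2) n) x)"
  define d where "d = (\<lambda>n. poly (pderiv (gegenbauer (1/2) n)) x)"
  have A: "d (Suc (Suc (Suc n))) = x * d (Suc (Suc n)) + real (n + 3) * p (Suc (Suc n))"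
    using pderiv_legendre_step[of "Suc (Suc n)" x, THEN conjunct1]
    by (simp del: gegenbauer.simps add: p_def d_def add_ac)
  have B: "x * d (Suc (Suc n)) = d (Suc n) + real (n + 2) * p (Suc (Suc n))"
    using pderiv_legendre_step[of "Suc n" x, THEN conjunct2]
    by (simp del: gegenbauer.simps add: p_def d_def add_ac)
  have "real (n + 2) * d (Suc (Suc (Suc n)))
      = (2 * real n + 5) * (x * d (Suc (Suc n))) - (real n + 3) * d (Suc n)"
    unfolding A B by (simp add: algebra_simps)
  also have "\<dots> = real (n + 2) * poly (gegenbauer (3/2) (Suc (Suc n))) x"
    using ge2 poly_gegenbauer_rec[of n "3/2" x] by (simp add: d_def algebra_simps)
  finally show ?case
    by (simp del: gegenbauer.simps add: d_def)
qed

section \<open>Central trinomial coefficients\<close>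

lemma coeff_central_trinomial_rec:
  fixes a b c :: real
  defines "T \<equiv> \<lambda>n. coeff ([:c, b, a:] ^ n) n"
  shows "real (n + 2) * T (Suc (Suc n)) =
    (2 * real n + 3) * b * T (Suc n) - (real n + 1) * (b\<^sup>2 - 4 * a * c) * T n"
proof -
  define Q where "Q = [:c, b, a:]"
  define X where "X = [:0, 1::real:]"
  \<comment> \<open>\<open>S / X\<close> is the image of \<open>Q / X\<close> under the Euler
    operator \<open>X d/dX\<close>.\<close>
  define S where "S = smult a (X\<^sup>2) - [:c:]"
  define F where "F = S * Q ^ Suc n"
  have Q: "Q = smult a (X\<^sup>2) + smult b X + [:c:]"
    by (simp add: Q_def X_def power2_eq_square)
  have dQ: "X * pderiv Q = Q + S"
    by (simp add: Q_def S_def X_def pderiv_pCons power2_eq_square)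
  have dS: "X * pderiv S = Q - smult b X + S"
    by (simp add: Q_def S_def X_def pderiv_pCons power2_eq_square)
  \<comment> \<open>This is \<open>(a X^2 + c)^2 - 4 a c X^2\<close> with
    \<open>a X^2 + c = Q - b X\<close>.\<close>
  have SS: "S\<^sup>2 = Q\<^sup>2 - smult (2 * b) (X * Q) + smult (b\<^sup>2 - 4 * a * c) (X\<^sup>2)"
    by (simp add: Q_def S_def X_def power2_eq_square algebra_simps)
  have "X * pderiv F = X * pderiv S * Q ^ Suc n
      + S * (smult (real (Suc n)) (Q ^ n) * (X * pderiv Q))"
    by (simp only: F_def pderiv_mult pderiv_power_Suc algebra_simps)
  also have "\<dots> = (Q - smult b X + S) * Q ^ Suc n
      + S * (smult (real (Suc n)) (Q ^ n) * (Q + S))"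
    by (simp only: dQ dS)
  also have "\<dots> = Q ^ Suc (Suc n) - smult b (X * Q ^ Suc n) + smult (real (n + 2)) F
      + smult (real (Suc n)) (S\<^sup>2 * Q ^ n)"
    by (simp add: F_def algebra_simps power2_eq_square smult_add_left smult_add_right numeral_poly)
  also have "\<dots> = Q ^ Suc (Suc n) - smult b (X * Q ^ Suc n) + smult (real (n + 2)) F
      + smult (real (Suc n)) (Q ^ Suc (Suc n) - smult (2 * b) (X * Q ^ Suc n)
          + smult (b\<^sup>2 - 4 * a * c) (X * (X * Q ^ n)))"
    unfolding SS by (simp add: algebra_simps power2_eq_square smult_add_right smult_diff_right)
  \<comment> \<open>At the central index \<open>n + 2\<close> the Euler operator multiplies the
    coefficient of \<open>F\<close> by \<open>n + 2\<close>, so both terms in \<open>F\<close>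
    cancel and only central coefficients of powers of \<open>Q\<close> remain.\<close>
  finally have "coeff (X * pderiv F) (Suc (Suc n)) = coeff (Q ^ Suc (Suc n) - smult b (X * Q ^ Suc n)
      + smult (real (n + 2)) F + smult (real (Suc n)) (Q ^ Suc (Suc n) - smult (2 * b) (X * Q ^ Suc n)
          + smult (b\<^sup>2 - 4 * a * c) (X * (X * Q ^ n)))) (Suc (Suc n))"
    by (rule arg_cong)
  then show ?thesis
    unfolding T_def Q_def[symmetric]
    by (simp del: power_Suc add: X_def coeff_pderiv coeff_pCons algebra_simps)
qed

text \<open>Laplace's formula, with the integral replaced by a coefficient extraction.\<close>

lemma coeff_central_trinomial_legendre:
  fixes a b c z :: real
  assumes "b\<^sup>2 - 4 * a * c = z\<^sup>2" "z \<noteq> 0"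
  shows "coeff ([:c, b, a:] ^ n) n = z ^ n * poly (gegenbauer (1/2) n) (b / z)"
proof (induction n rule: induct_nat_012)
  case 0
  show ?case by simp
next
  case 1
  show ?case using assms(2) by simp
next
  case (ge2 n)
  define p where "p = (\<lambda>n. poly (gegenbauer (1/2) n) (b / z))"
  have "real (n + 2) * coeff ([:c, b, a:] ^ Suc (Suc n)) (Suc (Suc n)) =
    (2 * real n + 3) * b * (z ^ Suc n * p (Suc n)) - (real n + 1) * z\<^sup>2 * (z ^ n * p n)"
    unfolding coeff_central_trinomial_rec assms(1) ge2 p_def ..
  also have "\<dots> = z ^ Suc (Suc n) * ((2 * real n + 3) * (b / z * p (Suc n)) - (real n + 1) * p n)"
    using assms(2) by (simp add: field_simps power2_eq_square)
  also have "(2 * real n + 3) * (b / z * p (Suc n)) - (real n + 1) * p n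
      = real (n + 2) * p (Suc (Suc n))"
    using poly_gegenbauer_rec[of n "1/2" "b / z"] by (simp only: p_def) (simp add: algebra_simps)
  finally have "real (n + 2) * coeff ([:c, b, a:] ^ Suc (Suc n)) (Suc (Suc n))
      = real (n + 2) * (z ^ Suc (Suc n) * p (Suc (Suc n)))"
    by (simp only: mult_ac)
  then show ?case
    unfolding p_def by (metis mult_left_cancel of_nat_0_eq_iff add_is_0 zero_neq_numeral)
qed

section \<open>Rotations of binary forms and the addition theorem\<close>

lemma coeff_linear_power:
  fixes a b :: real
  assumes "k \<le> m"
  shows "coeff ([:b, a:] ^ m) k = real (m choose k) * a ^ k * b ^ (m - k)"
proof -
  have "[:b, a:] ^ m = (monom a 1 + [:b:]) ^ m"
    by (simp add: monom_Suc monom_0)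
  also have "\<dots> = (\<Sum>j\<le>m. monom (real (m choose j) * a ^ j * b ^ (m - j)) j)"
    unfolding binomial_ring
    by (intro sum.cong) (simp_all add: monom_power of_nat_poly smult_monom poly_const_pow mult_ac)
  finally show ?thesis
    using assms by (simp add: coeff_sum if_distrib sum.delta cong: if_cong)
qed

text \<open>The two sides are the matrix entries \<open>(n,k)\<close> and \<open>(k,n)\<close> of a rotation acting on binary
  forms of degree \<open>2 n\<close>; they are compared through their generating function in the \<open>k\<close>-th
  monomial.\<close>

lemma rotation_coeff_symmetric:
  fixes p q :: real
  assumes "k \<le> 2 * n"
  shows "real (2 * n choose k) * coeff ([:-q, p:] ^ k * [:p, q:] ^ (2 * n - k)) n
    = real (2 * n choose n) * coeff (([:q, p:] * [:p, -q:]) ^ n) k"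
proof -
  define f where "f = (\<lambda>k. coeff ([:-q, p:] ^ k * [:p, q:] ^ (2 * n - k)) n)"
  define L where "L = (\<Sum>k\<le>2 * n. monom (real (2 * n choose k) * f k) k)"
  define u v where "u = [:-q, p:]" and "v = [:p, q:]"
  have "poly L x = poly (smult (real (2 * n choose n)) (([:q, p:] * [:p, -q:]) ^ n)) x" for x
  proof -
    \<comment> \<open>The \<open>n\<close>-th coefficient of this power is computed twice: expanding
      in powers of \<open>x\<close> gives \<open>L\<close>, and the binomial theorem for a linear
      polynomial gives the closed form.\<close>
    have "[:p - q * x, p * x + q:] ^ (2 * n) = (smult x u + v) ^ (2 * n)"
      by (simp add: u_def v_def algebra_simps)
    also have "\<dots> = (\<Sum>k\<le>2 * n. smult (real (2 * n choose k) * x ^ k)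
        (u ^ k * v ^ (2 * n - k)))"
      unfolding binomial_ring
      by (intro sum.cong) (simp_all add: of_nat_poly smult_power mult_ac)
    finally have "coeff ([:p - q * x, p * x + q:] ^ (2 * n)) n = poly L x"
      by (simp add: L_def f_def u_def v_def coeff_sum poly_sum poly_monom mult_ac)
    moreover have "poly (smult (real (2 * n choose n)) (([:q, p:] * [:p, -q:]) ^ n)) x
        = real (2 * n choose n) * ((p * x + q) * (p - q * x)) ^ n"
      by (simp only: poly_smult poly_power poly_mult) (simp add: algebra_simps)
    ultimately show ?thesis
      by (simp add: coeff_linear_power power_mult_distrib)
  qed
  then have "L = smult (real (2 * n choose n)) (([:q, p:] * [:p, -q:]) ^ n)"
    by (simp add: poly_eq_poly_eq_iff[symmetric] fun_eq_iff)
  then have "coeff L k = coeff (smult (real (2 * n choose n)) (([:q, p:] * [:p, -q:]) ^ n)) k"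
    by simp
  then show ?thesis
    using assms by (simp add: L_def f_def coeff_sum if_distrib sum.delta cong: if_cong)
qed

text \<open>For the rotation of angle \<open>\<phi>\<close> with \<open>p = cos (\<phi>/2)\<close> and \<open>q = sin (\<phi>/2)\<close>, this is the addition
  theorem for \<open>P\<^sub>n(cos\<^sup>2 \<phi> + sin\<^sup>2 \<phi> cos \<theta>)\<close>, with \<open>X = exp (i \<theta>)\<close>: the Fourier coefficients are
  positive multiples of squares.\<close>

lemma coeff_homogenize_legendre_nonneg:
  fixes p q :: real
  assumes pq: "p\<^sup>2 + q\<^sup>2 = 1" and w: "w = 2 * p\<^sup>2 * q\<^sup>2"
  shows "coeff (homogenize n (gegenbauer (1/2) n) [:w, 1 - 2 * w, w:] [:0, 1:]) k \<ge> 0"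
proof -
  define U V where "U = [:-q, p:]" and "V = [:p, q:]"
  define E where "E = ([:q, p:] * [:p, -q:]) ^ n"
  define f where "f = (\<lambda>k. coeff (U ^ k * V ^ (2 * n - k)) n)"
  define G where "G = (\<Sum>k\<le>2 * n. monom (coeff E k * f k) k)"
  have V: "V \<noteq> 0"
    using pq by (auto simp: V_def)
  have "degree ([:q, p:] * [:p, -q:]) \<le> 2"
    by (rule order.trans[OF degree_mult_le]) simp
  then have degE: "degree E \<le> 2 * n"
    unfolding E_def by (intro order.trans[OF degree_power_le]) simp
  have polyE: "poly E t = ((p * t + q) * (p - q * t)) ^ n" for t
    unfolding E_def by (simp only: poly_power poly_mult) (simp add: algebra_simps)
  have "homogenize n (gegenbauer (1/2) n) [:w, 1 - 2 * w, w:] [:0, 1:] = G"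
  proof (rule poly_eq_off_zeros[of "[:0, 1:]"])
    fix z :: real
    assume "poly [:0, 1:] z \<noteq> 0"
    then have z: "z \<noteq> 0" by simp
    \<comment> \<open>These are the entries of \<open>diag(z, 1)\<close> conjugated by the rotation
      with entries \<open>p\<close>, \<open>q\<close>; hence the determinant is
      \<open>z\<close>.\<close>
    define a b c d where "a = p\<^sup>2 * z + q\<^sup>2" and "b = p * q * (1 - z)"
      and "c = p * q * (1 - z)" and "d = p\<^sup>2 + q\<^sup>2 * z"
    have "a * d - b * c = z * (p\<^sup>2 + q\<^sup>2)\<^sup>2"
      by (simp add: a_def b_def c_def d_def algebra_simps power2_eq_square)
    then have "(a * d - b * c)\<^sup>2 = z\<^sup>2"
      unfolding pq by simp
    then have disc: "(a * d + b * c)\<^sup>2 - 4 * (a * c) * (b * d) = z\<^sup>2"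
      by (simp add: algebra_simps power2_eq_square)
    have q2: "q\<^sup>2 = 1 - p\<^sup>2"
      using pq by simp
    have "b * c = p\<^sup>2 * q\<^sup>2 * (1 - z)\<^sup>2"
      by (simp add: b_def c_def power2_eq_square)
    then have mid: "a * d + b * c = poly [:w, 1 - 2 * w, w:] z"
      unfolding a_def d_def w q2 by (simp add: algebra_simps power2_eq_square)
    \<comment> \<open>The \<open>n\<close>-th coefficient of this polynomial is again found twice:
      the right side yields the Legendre value, while expanding the left side in powers of
      \<open>z\<close> yields \<open>poly G z\<close>.\<close>
    have "homogenize (2 * n) E (smult z U) V = [:b * d, a * d + b * c, a * c:] ^ n"
    proof (rule poly_eq_off_zeros[OF V])
      fix y
      assume y: "poly V y \<noteq> 0"
      define u v where "u = poly U y" and "v = poly V y"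
      have "poly (homogenize (2 * n) E (smult z U) V) y
          = (v * v * ((p * (z * u / v) + q) * (p - q * (z * u / v)))) ^ n"
        unfolding poly_homogenize[OF degE y] polyE
        by (simp add: u_def v_def power_mult power_mult_distrib power2_eq_square)
      also have "v * v * ((p * (z * u / v) + q) * (p - q * (z * u / v)))
          = (p * z * u + q * v) * (p * v - q * z * u)"
        using y by (simp add: v_def field_simps)
      also have "p * z * u + q * v = a * y + b"
        by (simp add: u_def v_def U_def V_def a_def b_def algebra_simps power2_eq_square)
      also have "p * v - q * z * u = c * y + d"
        by (simp add: u_def v_def U_def V_def c_def d_def algebra_simps power2_eq_square)
      also have "(a * y + b) * (c * y + d) = poly [:b * d, a * d + b * c, a * c:] y"
        by (simp add: algebra_simps)
      finally show "poly (homogenize (2 * n) E (smult z U) V) y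
          = poly ([:b * d, a * d + b * c, a * c:] ^ n) y"
        by (simp only: poly_power)
    qed
    then have "coeff (homogenize (2 * n) E (smult z U) V) n
        = z ^ n * poly (gegenbauer (1/2) n) (poly [:w, 1 - 2 * w, w:] z / z)"
      using coeff_central_trinomial_legendre[OF disc z] mid by simp
    moreover have "coeff (homogenize (2 * n) E (smult z U) V) n = poly G z"
      by (simp add: homogenize_def G_def f_def coeff_sum poly_sum poly_monom smult_power mult_ac)
    ultimately show "poly (homogenize n (gegenbauer (1/2) n) [:w, 1 - 2 * w, w:] [:0, 1:]) z = poly G z"
      using z by (simp add: poly_homogenize[OF degree_gegenbauer_le])
  qed simp
  moreover have "coeff E j * f j \<ge> 0" if "j \<le> 2 * n" for j
  proof -
    \<comment> \<open>Symmetry makes \<open>f j\<close> a positive multiple of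
      \<open>coeff E j\<close>.\<close>
    have "real (2 * n choose j) * f j = real (2 * n choose n) * coeff E j"
      using rotation_coeff_symmetric[OF that] by (simp only: E_def f_def U_def V_def)
    then have "real (2 * n choose j) * (coeff E j * f j) = real (2 * n choose n) * (coeff E j)\<^sup>2"
      by (simp add: power2_eq_square mult_ac)
    then have "real (2 * n choose j) * (coeff E j * f j) \<ge> 0"
      by simp
    moreover have "real (2 * n choose j) > 0"
      using that by simp
    ultimately show ?thesis
      by (simp only: zero_le_mult_iff) linarith
  qed
  ultimately show ?thesis
    by (simp add: G_def coeff_sum if_distrib sum.delta cong: if_cong)
qed

section \<open>The Euler operator and division by \<open>X^2 - 1\<close>\<close>

lemma smult_sum_right: "smult c (sum f A) = (\<Sum>a\<in>A. smult c (f a))"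
  by (induction A rule: infinite_finite_induct) (simp_all add: smult_add_right)

text \<open>This is the chain rule for \<open>X d/dX\<close> applied to \<open>p(u/X)\<close>,
  multiplied by \<open>X^(n+1)\<close>; the subtracted term removes the derivative of that
  factor.\<close>

lemma euler_homogenize:
  "[:0, 1:] * pderiv (homogenize (Suc n) p u [:0, 1:]) - smult (real (Suc n)) (homogenize (Suc n) p u [:0, 1:])
    = ([:0, 1:] * pderiv u - u) * homogenize n (pderiv p) u [:0, 1:]"
proof -
  define X where "X = [:0, 1::real:]"
  have X: "pderiv X = 1" by (simp add: X_def pderiv_pCons)
  have 1: "X * pderiv (X ^ m) = smult (real m) (X ^ m)" for m
    by (cases m) (simp_all del: power_Suc of_nat_Suc add: pderiv_power_Suc X, simp)
  define t where "t = (\<lambda>k. X * pderiv (u ^ k * X ^ (Suc n - k)) - smult (real (Suc n)) (u ^ k * X ^ (Suc n - k)))"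
  have t: "t (Suc k) = smult (real (Suc k)) ((X * pderiv u - u) * (u ^ k * X ^ (n - k)))" if "k \<le> n" for k
  proof -
    have "t (Suc k) = u ^ Suc k * (X * pderiv (X ^ (n - k))) + smult (real (Suc k)) (u ^ k) * pderiv u * X * X ^ (n - k)
        - smult (real (Suc n)) (u ^ Suc k * X ^ (n - k))"
      by (simp only: t_def pderiv_mult pderiv_power_Suc diff_Suc_Suc algebra_simps)
    also have "\<dots> = smult (real (n - k) - real (Suc n)) (u ^ Suc k * X ^ (n - k))
        + smult (real (Suc k)) (u ^ k * pderiv u * X * X ^ (n - k))"
      unfolding 1 by (simp del: power_Suc of_nat_Suc add: smult_diff_left)
    also have "real (n - k) - real (Suc n) = - real (Suc k)"
      using that by simp
    finally show ?thesis
      by (simp del: of_nat_Suc add: algebra_simps smult_diff_right)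
  qed
  \<comment> \<open>The constant term of \<open>p\<close> contributes only \<open>X^(n+1)\<close>,
    which is annihilated; the index shift below then produces the coefficients of
    \<open>pderiv p\<close>.\<close>
  have t0: "t 0 = 0"
    by (simp del: power_Suc of_nat_Suc add: t_def 1)
  have "X * pderiv (homogenize (Suc n) p u X) - smult (real (Suc n)) (homogenize (Suc n) p u X)
      = (\<Sum>k\<le>Suc n. smult (coeff p k) (t k))"
    unfolding homogenize_def t_def
    by (simp only: higher_pderiv_sum[of 1, simplified] pderiv_smult sum_distrib_left smult_sum_right
        sum_subtractf[symmetric] smult_diff_right mult_smult_right smult_smult mult.commute)
  also have "\<dots> = (\<Sum>k\<le>n. smult (coeff p (Suc k)) (t (Suc k)))"
    unfolding sum.atMost_Suc_shift t0 by simp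
  also have "\<dots> = (X * pderiv u - u) * homogenize n (pderiv p) u X"
    unfolding homogenize_def sum_distrib_left
    by (intro sum.cong) (simp_all del: of_nat_Suc add: t coeff_pderiv mult_ac)
  finally show ?thesis
    by (simp only: X_def)
qed

text \<open>Dividing by \<open>X\<^sup>2 - 1\<close>, the coefficients of \<open>h\<close> are partial sums of nonnegative terms: from the
  bottom up to the index \<open>N\<close> where the sign of \<open>j - N\<close> changes, and from the top down to it.\<close>

lemma coeff_nonneg_euler:
  fixes g h :: "real poly"
  assumes w: "w > 0" and g: "\<And>k. coeff g k \<ge> 0"
    and eq: "[:0, 1:] * pderiv g - smult (real N) g = [:-w, 0, w:] * h"
  shows "coeff h k \<ge> 0"
proof -
  have c: "(real k - real N) * coeff g k = coeff ([:-w, 0, w:] * h) k" for k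
    unfolding eq[symmetric] by (cases k) (simp_all add: coeff_pCons coeff_pderiv algebra_simps)
  have step: "w * coeff h (Suc (Suc k)) = w * coeff h k + (real N - real (Suc (Suc k))) * coeff g (Suc (Suc k))" for k
    using c[of "Suc (Suc k)"] by (simp add: coeff_pCons algebra_simps)
  have up: "k \<le> N \<longrightarrow> w * coeff h k \<ge> 0" for k
  proof (induction k rule: induct_nat_012)
    case 0
    show ?case using c[of 0] mult_nonneg_nonneg[of "real N", OF _ g[of 0]] by (auto simp: coeff_pCons)
  next
    case 1
    show ?case using c[of 1] mult_nonneg_nonneg[of "real N - 1", OF _ g[of 1]]
      by (auto simp: coeff_pCons algebra_simps)
  next
    case (ge2 k)
    then show ?case unfolding step using g by auto
  qed
  \<comment> \<open>The bound is on \<open>k + 2\<close> because passing from \<open>k + 2\<close>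
    down to \<open>k\<close> uses the coefficient of \<open>g\<close> at \<open>k + 2\<close>, whose
    factor is nonpositive from \<open>N\<close> on. The induction starts above the degree of
    \<open>h\<close>.\<close>
  have down: "N \<le> k + 2 \<longrightarrow> w * coeff h k \<ge> 0" for k
  proof (induction "Suc (degree h) - k" arbitrary: k rule: less_induct)
    case less
    show ?case
    proof (cases "k \<le> degree h")
      case False
      then show ?thesis by (simp add: coeff_eq_0)
    next
      case True
      then have "N \<le> k + 2 \<longrightarrow> w * coeff h (Suc (Suc k)) \<ge> 0"
        using less(1)[of "Suc (Suc k)"] by auto
      moreover have "N \<le> k + 2 \<longrightarrow> (real N - real (Suc (Suc k))) * coeff g (Suc (Suc k)) \<le> 0"
        using g by (auto intro!: mult_nonpos_nonneg)
      ultimately show ?thesis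
        using step[of k] by linarith
    qed
  qed
  have "w * coeff h k \<ge> 0"
    using up[of k] down[of k] by linarith
  then show ?thesis
    using w by (simp add: zero_le_mult_iff)
qed

lemma coeff_homogenize_gegenbauer_nonneg:
  fixes w :: real
  assumes "0 < w" "w \<le> 1/2"
  shows "coeff (homogenize n (gegenbauer (3/2) n) [:w, 1 - 2 * w, w:] [:0, 1:]) k \<ge> 0"
proof -
  \<comment> \<open>Since \<open>2 w\<close> is the squared sine of the angle, \<open>r\<close> is
    its cosine, and \<open>p\<close>, \<open>q\<close> are the cosine and sine of half the
    angle.\<close>
  define r where "r = sqrt (1 - 2 * w)"
  define p q where "p = sqrt ((1 + r) / 2)" and "q = sqrt ((1 - r) / 2)"
  have r: "0 \<le> r" "r \<le> 1" "r\<^sup>2 = 1 - 2 * w"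
    using assms by (simp_all add: r_def)
  have p: "p\<^sup>2 = (1 + r) / 2" and q: "q\<^sup>2 = (1 - r) / 2"
    using r by (simp_all add: p_def q_def)
  have pq: "p\<^sup>2 + q\<^sup>2 = 1"
    unfolding p q by (simp add: field_simps)
  have w: "w = 2 * p\<^sup>2 * q\<^sup>2"
    unfolding p q using r(3) by (simp add: field_simps power2_eq_square)
  have d: "pderiv (gegenbauer (1/2) (Suc n)) = gegenbauer (3/2) n"
    using pderiv_legendre by (simp add: poly_eq_poly_eq_iff[symmetric] fun_eq_iff)
  have e: "[:0, 1:] * pderiv [:w, 1 - 2 * w, w:] - [:w, 1 - 2 * w, w:] = [:-w, 0, w:]"
    by (simp add: pderiv_pCons)
  show ?thesis
    using euler_homogenize[of n "gegenbauer (1/2) (Suc n)" "[:w, 1 - 2 * w, w:]", unfolded d e]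
    by (rule coeff_nonneg_euler[OF assms(1) coeff_homogenize_legendre_nonneg[OF pq w]])
qed

section \<open>Polynomials in the shift operator\<close>

text \<open>Here \<open>X\<close> acts as the shift by one grid point; negative powers of
  \<open>X\<close> are expressed by displacing \<open>i\<close>.\<close>

definition stencil :: "real poly \<Rightarrow> (int \<Rightarrow> real) \<Rightarrow> int \<Rightarrow> real" where
  "stencil p u i = (\<Sum>j\<le>degree p. coeff p j * u (i + int j))"

lemma stencil_altdef_le:
  assumes "degree p \<le> N"
  shows "stencil p u i = (\<Sum>j\<le>N. coeff p j * u (i + int j))"
  unfolding stencil_def using assms
  by (intro sum.mono_neutral_left) (auto simp: coeff_eq_0)

lemma stencil_0: "stencil 0 u i = 0"
  by (simp add: stencil_def)

lemma stencil_add: "stencil (p + q) u i = stencil p u i + stencil q u i"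
proof -
  define N where "N = max (degree p) (degree q)"
  have "degree (p + q) \<le> N" "degree p \<le> N" "degree q \<le> N"
    by (simp_all add: N_def degree_add_le)
  then show ?thesis
    by (simp add: stencil_altdef_le[of _ N] algebra_simps sum.distrib)
qed

lemma stencil_smult: "stencil (smult c p) u i = c * stencil p u i"
  by (simp add: stencil_altdef_le[OF degree_smult_le] stencil_def sum_distrib_left mult_ac)

lemma stencil_sum: "stencil (sum f A) u i = (\<Sum>a\<in>A. stencil (f a) u i)"
  by (induction A rule: infinite_finite_induct) (simp_all add: stencil_0 stencil_add)

lemma stencil_pCons: "stencil (pCons c p) u i = c * u i + stencil p u (i + 1)"
proof -
  have "stencil (pCons c p) u i = (\<Sum>j\<le>Suc (degree p). coeff (pCons c p) j * u (i + int j))"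
    by (rule stencil_altdef_le[OF degree_pCons_le])
  then show ?thesis
    unfolding sum.atMost_Suc_shift by (simp add: stencil_def add_ac)
qed

lemma stencil_mult_X_power: "stencil (p * [:0, 1:] ^ m) u i = stencil p u (i + int m)"
  by (induction m arbitrary: i) (simp_all add: stencil_pCons add_ac)

text \<open>As \<open>A\<close> is \<open>R / X\<close> in the shift \<open>X\<close>, its power is
  \<open>R^m / X^m\<close>; the offset \<open>i - int m\<close> accounts for the
  denominator.\<close>

lemma funpow_three_point:
  assumes "\<And>v k. A v k = w * v (k - 1) + c * v k + w * v (k + 1)"
  shows "(A ^^ m) u i = stencil ([:w, c, w:] ^ m) u (i - int m)"
proof (induction m arbitrary: i)
  case 0
  show ?case by (simp add: stencil_def)
next
  case (Suc m)
  have "(A ^^ Suc m) u i = A ((A ^^ m) u) i"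
    by simp
  also have "\<dots> = stencil ([:w, c, w:] ^ Suc m) u (i - int (Suc m))"
    unfolding assms[of "(A ^^ m) u" i] Suc
    by (simp add: stencil_add stencil_smult stencil_pCons algebra_simps)
  finally show ?case .
qed

text \<open>The factors \<open>X^(N-k)\<close> in \<open>homogenize\<close> bring the different
  offsets \<open>i - k\<close> to the common offset \<open>i - N\<close>.\<close>

lemma poly_op_three_point:
  assumes "\<And>v k. A v k = w * v (k - 1) + c * v k + w * v (k + 1)" and "degree p \<le> N"
  shows "poly_op p A u i = stencil (homogenize N p [:w, c, w:] [:0, 1:]) u (i - int N)"
proof -
  have "poly_op p A u i = (\<Sum>k\<le>N. coeff p k * (A ^^ k) u i)"
    unfolding poly_op_def using assms(2)
    by (intro sum.mono_neutral_left) (auto simp: coeff_eq_0)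
  also have "\<dots> = stencil (homogenize N p [:w, c, w:] [:0, 1:]) u (i - int N)"
    unfolding homogenize_def stencil_sum stencil_smult stencil_mult_X_power
    by (intro sum.cong) (simp_all add: funpow_three_point[OF assms(1)] of_nat_diff)
  finally show ?thesis .
qed

section \<open>Monotonicity of stencils and of the RKG2 step\<close>

lemma monotone_method_stencil:
  assumes H: "\<And>u i. H u i = c * u i + stencil p u (i - int N)"
    and "c \<ge> 0" "\<And>k. coeff p k \<ge> 0"
  shows "monotone_method H"
  unfolding monotone_method_def
proof (intro conjI allI)
  show "finite_stencil H"
    unfolding finite_stencil_def
  proof
    fix i :: int
    show "\<exists>J. finite J \<and> (\<forall>u v. (\<forall>j\<in>J. u j = v j) \<longrightarrow> H u i = H v i)"
      by (rule exI[of _ "insert i ((\<lambda>j. i - int N + int j) ` {..degree p})"])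
        (auto simp: H stencil_def)
  qed
next
  fix u :: "int \<Rightarrow> real" and i j :: int
  define e where "e = (\<lambda>m. if m = j then 1 else 0 :: real)"
  have e: "((\<lambda>x. (u(j := x)) m) has_real_derivative e m) (at (u j))" for m
    by (cases "m = j") (simp_all add: e_def)
  \<comment> \<open>The identity term and the stencil can both involve \<open>u j\<close>, so their
    contributions are added.\<close>
  define D where "D = c * e i + (\<Sum>k\<le>degree p. coeff p k * e (i - int N + int k))"
  have "((\<lambda>x. H (u(j := x)) i) has_real_derivative D) (at (u j))"
    unfolding H stencil_def D_def by (intro DERIV_add DERIV_cmult DERIV_sum e)
  moreover have "D \<ge> 0"
    unfolding D_def e_def using assms by (intro add_nonneg_nonneg sum_nonneg) auto
  ultimately show "\<exists>D. ((\<lambda>x. H (u(j := x)) i) has_real_derivative D) (at (u j)) \<and> D \<ge> 0"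
    by blast
qed

theorem corollary5p11:
  fixes \<alpha> dt dx :: real and s :: nat
  assumes "\<alpha> > 0" and "dt > 0" and "dx > 0" and "s \<ge> 2"
    and "\<alpha> * (dt / dx ^ 2) \<le> (real s + 4) * (real s - 1) / 12"
  shows "monotone_method (rkg2_step s \<alpha> dt dx)"
proof -
  define K where "K = (real s + 4) * (real s - 1)"
  define w where "w = 6 * (\<alpha> * (dt / dx ^ 2)) / K"
  define a where "a = 1 - 2 * (real s - 1) * (real s + 4) / (3 * real s * (real s + 3))"
  define b where "b = 4 * (real s - 1) * (real s + 4) / (3 * real s * (real s + 1) * (real s + 2) * (real s + 3))"
  have s: "real s \<ge> 2"
    using assms(4) by simp
  then have K: "K > 0"
    by (simp add: K_def)
  have w: "0 < w" "w \<le> 1/2"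
    using assms(1-3) assms(5)[folded K_def] K by (simp_all add: w_def divide_simps mult_ac)
  \<comment> \<open>The right side exceeds the left by \<open>s^2 + 3 s + 8\<close>.\<close>
  have "2 * (real s - 1) * (real s + 4) \<le> 3 * real s * (real s + 3)"
    using s by (simp add: algebra_simps)
  then have a: "a \<ge> 0"
    using s by (simp add: a_def divide_simps)
  have b: "b \<ge> 0"
    using s by (simp add: b_def)
  define A where "A = (\<lambda>v k. v k + 6 * dt / ((real s + 4) * (real s - 1)) * (\<alpha> * central_diff dx v k))"
  have A: "A v k = w * v (k - 1) + (1 - 2 * w) * v k + w * v (k + 1)" for v k
    unfolding A_def K_def[symmetric] w_def central_diff_def
    by (simp add: algebra_simps add_divide_distrib diff_divide_distrib)
  define h where "h = homogenize s (gegenbauer (3/2) s) [:w, 1 - 2 * w, w:] [:0, 1:]"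
  have "rkg2_step s \<alpha> dt dx u i = a * u i + stencil (smult b h) u (i - int s)" for u i
    unfolding rkg2_step_def h_def stencil_smult poly_op_three_point[OF A degree_gegenbauer_le, symmetric]
    by (simp only: A_def a_def b_def)
  moreover have "coeff (smult b h) k \<ge> 0" for k
    using b coeff_homogenize_gegenbauer_nonneg[OF w] by (simp add: h_def)
  ultimately show ?thesis
    using a by (intro monotone_method_stencil)
qed

end
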